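(* Let $m,n\ge 1$ be integers and $r=\min\{m,n\}$. A continuous map $\mathscr{U}\colon\mathbb{R}^{m\times n}\to\mathbb{R}^{m\times n}$ satisfies $$\mathscr{U}(PDQ^\top)=P\,\mathscr{U}(D)\,Q^\top$$ for all $D\in\mathbb{R}^{m\times n}$, all $P\in\mathbb{O}^m$ and all $Q\in\mathbb{O}^n$ if and only if $\mathscr{U}$ is a spectral operator, i.e. if and only if there exists an absolutely symmetric map $\psi\colon\mathbb{R}^r\to\mathbb{R}^r$ such that, for every $D\in\mathbb{R}^{m\times n}$ and every singular value decomposition $D=U\,\mathrm{Diag}(\sigma(D))\,V^\top$, $$\mathscr{U}(D)=U\,\mathrm{Diag}(\psi(\sigma(D)))\,V^\top .$$
   Context: $\mathbb{O}^d$ denotes the set of $d\times d$ real orthogonal matrices. $\sigma(D)=(\sigma_1(D),\dots,\sigma_r(D))^\top$ is the vector of singular values of $D$ in nonincreasing order. For $x\in\mathbb{R}^r$, $\mathrm{Diag}(x)$ denotes here the $m\times n$ matrix with $(i,i)$ entry $x_i$ for $1\le i\le r$ and all other entries $0$; a singular value decomposition $D=U\,\mathrm{Diag}(\sigma(D))V^\top$ has $U\in\mathbb{O}^m$, $V\in\mathbb{O}^n$. A map $\psi\colon\mathbb{R}^r\to\mathbb{R}^r$ is absolutely symmetric if $\psi(Sx)=S\psi(x)$ for every $x\in\mathbb{R}^r$ and every signed permutation matrix $S\in\mathbb{R}^{r\times r}$ (a permutation matrix with entries possibly multiplied by $\pm1$). No continuity of $\psi$ is asserted. *)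

theory Defs
  imports "HOL-Analysis.Analysis"
begin

text \<open>
  A real $m \times n$ matrix has type \<^typ>\<open>real^'n^'m\<close>. Diagonal entries of rectangular matrices
  only make sense for ordered row and column indices, so index types are finite linear orders;
  every size $\ge 1$ is realised by such a type.
\<close>

text \<open>0-based position of an index: a bijection onto \<open>{..<CARD('a)}\<close>.\<close>

definition idx :: "'a::{finite,linorder} \<Rightarrow> nat" where
  "idx i = card {j. j < i}"

text \<open>
  The sum has at most one nonzero term: it is \<open>x $ k\<close> if \<open>i\<close>, \<open>j\<close> and \<open>k\<close> all have the same
  position, and 0 if there is no such \<open>k\<close>.
\<close>

definition Diag :: "real^'r::{finite,linorder} \<Rightarrow> real^'n::{finite,linorder}^'m::{finite,linorder}" where
  "Diag x = (\<chi> i j. \<Sum>k\<in>UNIV. if idx i = idx k \<and> idx j = idx k then x $ k else 0)"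

definition charpoly :: "real^'n^'n \<Rightarrow> real poly" where
  "charpoly A = det (mat [:0, 1:] - (\<chi> i j. [:A $ i $ j:]))"

text \<open>
  Square roots of the eigenvalues of $D^\top D$, with algebraic multiplicity, in nonincreasing
  order. The list has $n$ entries, since a symmetric matrix has only real eigenvalues; the
  singular values are the first $r = \min\{m,n\}$ of them (the rest, if any, vanish).
\<close>

definition singular_value_list :: "real^'n^'m \<Rightarrow> real list" where
  "singular_value_list D =
     rev (sorted_list_of_multiset (image_mset sqrt (proots (charpoly (transpose D ** D)))))"

text \<open>Meaningful only for \<open>CARD('r) = min (CARD('m)) (CARD('n))\<close>.\<close>

definition singular_values :: "real^'n^'m \<Rightarrow> real^'r::{finite,linorder}" where
  "singular_values D = (\<chi> i. singular_value_list D ! idx i)"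

definition signed_permutation_matrix :: "real^'r^'r \<Rightarrow> bool" where
  "signed_permutation_matrix S \<longleftrightarrow>
     (\<exists>p s. p permutes UNIV \<and> (\<forall>i. s i = 1 \<or> s i = -1) \<and>
            S = (\<chi> i j. if j = p i then s i else 0))"

definition absolutely_symmetric :: "(real^'r \<Rightarrow> real^'r) \<Rightarrow> bool" where
  "absolutely_symmetric \<psi> \<longleftrightarrow>
     (\<forall>x S. signed_permutation_matrix S \<longrightarrow> \<psi> (S *v x) = S *v \<psi> x)"

definition is_svd ::
  "real^'n::{finite,linorder}^'m::{finite,linorder} \<Rightarrow> real^'m::{finite,linorder}^'m::{finite,linorder} \<Rightarrow>
   real^'r::{finite,linorder} \<Rightarrow> real^'n::{finite,linorder}^'n::{finite,linorder} \<Rightarrow> bool" where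
  "is_svd D U s V \<longleftrightarrow>
     orthogonal_matrix U \<and> orthogonal_matrix V \<and> s = singular_values D \<and>
     D = U ** Diag s ** transpose V"

definition spectral_operator_of ::
  "(real^'r::{finite,linorder} \<Rightarrow> real^'r::{finite,linorder}) \<Rightarrow>
   (real^'n::{finite,linorder}^'m::{finite,linorder} \<Rightarrow>
    real^'n::{finite,linorder}^'m::{finite,linorder}) \<Rightarrow> bool" where
  "spectral_operator_of \<psi> F \<longleftrightarrow>
     absolutely_symmetric \<psi> \<and>
     (\<forall>D U s V. is_svd D U s V \<longrightarrow> F D = U ** Diag (\<psi> s) ** transpose V)"

end

theory Submission
  imports Defs
begin

text \<open>
  An equivariant map sends diagonal matrices to diagonal matrices, because conjugation by a suitable
  pair of sign matrices fixes the argument and negates a given off-diagonal entry of the value;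
  signed permutations lift to pairs of orthogonal matrices, which gives absolute symmetry.

  Conversely, a singular value decomposition of \<open>D\<close> is found by maximising
  \<open>trace (W\<^sup>T U\<^sup>T D V)\<close> over the compact set of pairs of orthogonal matrices, where \<open>W\<close> is
  diagonal with strictly decreasing positive weights. For a maximiser, \<open>A = U\<^sup>T D V\<close> makes both
  \<open>A W\<^sup>T\<close> and \<open>W\<^sup>T A\<close> symmetric, whence \<open>A (W\<^sup>T W) = (W W\<^sup>T) A\<close>. The weights being distinct, this
  forces \<open>A\<close> to be diagonal, and comparison with signed permutations shows that its diagonal is
  nonnegative and nonincreasing.
\<close>

section \<open>Positions and rectangular diagonal matrices\<close>

lemma idx_less: "i < j \<Longrightarrow> idx i < idx j"
  unfolding idx_def by (intro psubset_card_mono) auto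

lemma idx_less_CARD: "idx (i :: 'a::{finite,linorder}) < CARD('a)"
  unfolding idx_def by (intro psubset_card_mono) auto

lemma inj_idx: "inj idx"
  by (intro linorder_injI) (metis idx_less less_irrefl)

lemma idx_eq_iff [simp]: "idx i = idx j \<longleftrightarrow> i = j"
  using inj_idx by (auto simp: inj_def)

lemma inv_idx_idx [simp]: "inv idx (idx i) = i"
  by (rule inv_f_f[OF inj_idx])

lemma range_idx: "range (idx :: 'a::{finite,linorder} \<Rightarrow> nat) = {..<CARD('a)}"
proof (rule card_subset_eq)
  show "card (range (idx :: 'a \<Rightarrow> nat)) = card {..<CARD('a)}"
    by (simp add: card_image[OF inj_idx])
qed (auto simp: idx_less_CARD)

lemma idx_inv_idx:
  assumes "k < CARD('a::{finite,linorder})"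
  shows "idx (inv idx k :: 'a) = k"
  using assms by (intro f_inv_into_f) (simp add: range_idx)

lemma sum_idx:
  "(\<Sum>i\<in>(UNIV :: 'a::{finite,linorder} set). g (idx i)) = (\<Sum>k<CARD('a). g k)"
  by (metis (no_types, lifting) inj_idx range_idx sum.reindex_cong)

text \<open>The size hypothesis makes equal row and column positions lie below
  \<open>CARD('r)\<close>, so \<open>inv idx\<close> reaches a genuine index of type
  \<open>'r\<close> and no range test is needed.\<close>

lemma Diag_nth:
  fixes x :: "real^'r::{finite,linorder}"
  assumes "CARD('r) = min (CARD('m)) (CARD('n))"
  shows "(Diag x :: real^'n::{finite,linorder}^'m::{finite,linorder}) $ i $ j =
         (if idx i = idx j then x $ inv idx (idx i) else 0)"
proof (cases "idx i = idx j")
  case True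
  then have "idx i < CARD('r)"
    using idx_less_CARD[of i] idx_less_CARD[of j] assms by simp
  then have k: "idx (inv idx (idx i) :: 'r) = idx i"
    by (rule idx_inv_idx)
  have eq: "idx i = idx l \<and> idx j = idx l \<longleftrightarrow> l = inv idx (idx i)" for l :: 'r
    using True k by (metis inv_idx_idx)
  show ?thesis
    unfolding Diag_def vec_lambda_beta eq using True by simp
next
  case False
  then have "\<not> (idx i = idx l \<and> idx j = idx l)" for l :: 'r by simp
  then show ?thesis using False by (auto simp: Diag_def intro!: sum.neutral)
qed

text \<open>Turns the trace objective of \<open>svd_exists\<close> into an inner product, so that
  maximality can be read as an inequality between vectors.\<close>

lemma trace_transpose_Diag_mul:
  fixes x y :: "real^'r::{finite,linorder}"
  assumes r: "CARD('r) = min (CARD('m)) (CARD('n))"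
  shows "trace (transpose (Diag x :: real^'n::{finite,linorder}^'m::{finite,linorder}) ** Diag y) = x \<bullet> y"
proof -
  let ?X = "Diag x :: real^'n::_^'m::_" and ?Y = "Diag y :: real^'n::_^'m::_"
  let ?g = "\<lambda>k. x $ inv idx k * y $ inv idx k"
  have "trace (transpose ?X ** ?Y) = (\<Sum>j\<in>UNIV. \<Sum>i\<in>UNIV. ?X $ i $ j * ?Y $ i $ j)"
    by (simp add: trace_def matrix_matrix_mult_def transpose_def)
  also have "\<dots> = (\<Sum>j\<in>(UNIV::'n set). \<Sum>i\<in>(UNIV::'m set). if idx i = idx j then ?g (idx i) else 0)"
    by (intro sum.cong refl) (simp add: Diag_nth[OF r])
  also have "\<dots> = (\<Sum>j<CARD('n). \<Sum>i<CARD('m). if i = j then ?g i else 0)"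
    unfolding sum_idx[where g = "\<lambda>i. if i = _ then ?g i else 0"]
      sum_idx[where g = "\<lambda>j. \<Sum>i<CARD('m). if i = j then ?g i else 0"] ..
  also have "\<dots> = (\<Sum>j<CARD('n). if j < CARD('m) then ?g j else 0)"
    by simp
  also have "\<dots> = (\<Sum>j<CARD('r). ?g j)"
    by (rule sum.mono_neutral_cong_right) (auto simp: r)
  also have "\<dots> = x \<bullet> y"
    unfolding sum_idx[symmetric] by (simp add: inner_vec_def)
  finally show ?thesis .
qed

text \<open>The two occurrences of \<open>Diag x\<close> have transposed shapes; this carries the
  formula for \<open>transpose W ** W\<close> over to \<open>W ** transpose W\<close>.\<close>

lemma transpose_Diag:
  fixes x :: "real^'r::{finite,linorder}"
  assumes "CARD('r) = min (CARD('m)) (CARD('n))"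
  shows "transpose (Diag x :: real^'n::{finite,linorder}^'m::{finite,linorder}) = Diag x"
  using assms by (auto simp: vec_eq_iff transpose_def Diag_nth min.commute)

lemma transpose_Diag_mul_Diag_nth:
  fixes x :: "real^'r::{finite,linorder}"
  assumes r: "CARD('r) = min (CARD('m)) (CARD('n))"
  shows "(transpose (Diag x :: real^'n::{finite,linorder}^'m::{finite,linorder}) ** Diag x) $ i $ j =
         (if i = j \<and> idx i < CARD('r) then (x $ inv idx (idx i))\<^sup>2 else 0)"
proof -
  let ?X = "Diag x :: real^'n::_^'m::_"
  have "?X $ k $ i * ?X $ k $ j = (if idx k = idx i \<and> i = j then (x $ inv idx (idx k))\<^sup>2 else 0)" for k
  proof (cases "i = j")
    case False
    then have "\<not> (idx k = idx i \<and> idx k = idx j)" by (metis idx_eq_iff)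
    then show ?thesis using False by (auto simp: Diag_nth[OF r])
  qed (simp add: Diag_nth[OF r] power2_eq_square)
  then have "(transpose ?X ** ?X) $ i $ j
      = (\<Sum>k\<in>(UNIV::'m set). if idx k = idx i \<and> i = j then (x $ inv idx (idx k))\<^sup>2 else 0)"
    by (simp add: matrix_matrix_mult_def transpose_def)
  also have "\<dots> = (\<Sum>k<CARD('m). if k = idx i \<and> i = j then (x $ inv idx k)\<^sup>2 else 0)"
    by (rule sum_idx)
  also have "\<dots> = (if i = j \<and> idx i < CARD('r) then (x $ inv idx (idx i))\<^sup>2 else 0)"
    using r idx_less_CARD[of i] by (cases "i = j") auto
  finally show ?thesis .
qed

section \<open>Signed permutations\<close>

text \<open>The left factor permutes and signs rows, the right one columns. Sign matrices are the
  case \<open>p = id\<close>, and orthogonality is the case \<open>X = mat 1\<close>.\<close>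

lemma signed_permutation_matrix_nth_mul:
  "((\<chi> i j. if j = p i then s i else 0) ** X ** transpose (\<chi> i j. if j = q i then t i else 0)) $ i $ j
   = s i * X $ p i $ q j * (t j :: real)"
  by (simp add: matrix_matrix_mult_def transpose_def if_distrib[of "\<lambda>x. x * _"]
      if_distrib[of "\<lambda>x. _ * x"] cong: if_cong)

lemma orthogonal_signed_permutation:
  fixes p :: "'a::finite \<Rightarrow> 'a" and s :: "'a \<Rightarrow> real"
  assumes "inj p" and s: "\<And>i. s i = 1 \<or> s i = -1"
  shows "orthogonal_matrix (\<chi> i j. if j = p i then s i else 0)" (is "orthogonal_matrix ?P")
proof -
  have "s i * s i = 1" for i using s[of i] by auto
  then have "(?P ** mat 1 ** transpose ?P) = mat 1"
    unfolding vec_eq_iff signed_permutation_matrix_nth_mul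
    using \<open>inj p\<close> by (auto simp: mat_def inj_eq)
  then show ?thesis
    by (simp add: orthogonal_matrix matrix_left_right_inverse)
qed

text \<open>Transport \<open>p\<close> along positions to the first \<open>CARD('r)\<close> indices
  of the larger type and fix all the others.\<close>

lemma permutation_lift:
  fixes p :: "'r::{finite,linorder} \<Rightarrow> 'r"
  assumes le: "CARD('r) \<le> CARD('a::{finite,linorder})" and p: "inj p"
  obtains q :: "'a::{finite,linorder} \<Rightarrow> 'a" where "inj q"
    and "\<And>i k. idx i = idx k \<Longrightarrow> idx (q i) = idx (p k)"
    and "\<And>i. \<not> idx i < CARD('r) \<Longrightarrow> q i = i"
proof
  define q where "q i = (if idx i < CARD('r) then inv idx (idx (p (inv idx (idx i)))) else i)" for i :: 'a
  have q: "idx (q i) = idx (p (inv idx (idx i)))" if "idx i < CARD('r)" for i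
    using that le idx_less_CARD[of "p (inv idx (idx i))"] by (simp add: idx_inv_idx q_def)
  have q_ge: "q i = i" if "\<not> idx i < CARD('r)" for i
    using that by (simp add: q_def)
  have q_lt: "idx (q i) < CARD('r)" if "idx i < CARD('r)" for i
    unfolding q[OF that] by (rule idx_less_CARD)
  show "inj q"
  proof (rule injI)
    fix i j assume eq: "q i = q j"
    \<comment> \<open>\<open>q\<close> preserves the block of positions below
      \<open>CARD('r)\<close> and fixes the rest, so the two blocks cannot collide.\<close>
    then have iff: "idx i < CARD('r) \<longleftrightarrow> idx j < CARD('r)"
      using q_lt q_ge by metis
    show "i = j"
    proof (cases "idx i < CARD('r)")
      case True
      then have i: "idx i < CARD('r)" and j: "idx j < CARD('r)" using iff by auto
      have "idx (p (inv idx (idx i))) = idx (p (inv idx (idx j)))"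
        using q[OF i] q[OF j] eq by simp
      then have "(inv idx (idx i) :: 'r) = inv idx (idx j)" using p by (simp add: inj_eq)
      then show ?thesis
        using idx_inv_idx[OF i] idx_inv_idx[OF j] by (metis idx_eq_iff)
    next
      case False
      then show ?thesis using eq iff q_ge by simp
    qed
  qed
  show "idx (q i) = idx (p k)" if "idx i = idx k" for i k
    using q[of i] that idx_less_CARD[of k] by simp
  show "q i = i" if "\<not> idx i < CARD('r)" for i using that by (rule q_ge)
qed

lemma signed_permutation_matrix_vec:
  "((\<chi> i j. if j = p i then s i else 0) *v x) $ i = s i * x $ p i" for s :: "'a::finite \<Rightarrow> real"
  by (simp add: matrix_vector_mult_def if_distrib[of "\<lambda>x. x * _"] cong: if_cong)

text \<open>Lifting the same permutation to rows and columns keeps diagonal entries on the diagonal.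
  \<open>P\<close> and \<open>Q\<close> are independent of \<open>x\<close>, which the proof of
  absolute symmetry needs.\<close>

lemma Diag_signed_permutation:
  fixes S :: "real^'r::{finite,linorder}^'r::{finite,linorder}"
  assumes r: "CARD('r) = min (CARD('m::{finite,linorder})) (CARD('n::{finite,linorder}))"
    and S: "signed_permutation_matrix S"
  obtains P :: "real^'m::{finite,linorder}^'m::{finite,linorder}" and Q :: "real^'n::{finite,linorder}^'n::{finite,linorder}"
  where "orthogonal_matrix P" "orthogonal_matrix Q"
    and "\<And>x. Diag (S *v x) = P ** Diag x ** transpose Q"
proof -
  obtain p s where p: "p permutes UNIV" and s: "\<And>i. s i = 1 \<or> s i = -1"
    and S: "S = (\<chi> i j. if j = p i then s i else 0)"
    using S unfolding signed_permutation_matrix_def by blast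
  have p: "inj p" using p by (rule permutes_inj)
  obtain q :: "'m \<Rightarrow> 'm" where q: "inj q"
    "\<And>i k. idx i = idx k \<Longrightarrow> idx (q i) = idx (p k)" "\<And>i. \<not> idx i < CARD('r) \<Longrightarrow> q i = i"
    using permutation_lift[OF _ p] r by (metis min.cobounded1)
  obtain q' :: "'n \<Rightarrow> 'n" where q': "inj q'"
    "\<And>i k. idx i = idx k \<Longrightarrow> idx (q' i) = idx (p k)" "\<And>i. \<not> idx i < CARD('r) \<Longrightarrow> q' i = i"
    using permutation_lift[OF _ p] r by (metis min.cobounded2)
  \<comment> \<open>The signs go to the row factor only: on both sides they would cancel on the
    diagonal. Surplus rows get sign 1.\<close>
  define e where "e i = (if idx i < CARD('r) then s (inv idx (idx i)) else 1)" for i :: 'm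
  define P :: "real^'m::_^'m::_" where "P = (\<chi> i j. if j = q i then e i else 0)"
  define Q :: "real^'n::_^'n::_" where "Q = (\<chi> i j. if j = q' i then 1 else 0)"
  show thesis
  proof
    show "orthogonal_matrix P" "orthogonal_matrix Q"
      unfolding P_def Q_def
      by (rule orthogonal_signed_permutation; use q(1) q'(1) s in \<open>simp add: e_def\<close>)+
    fix x
    have "(Diag (S *v x) :: real^'n::_^'m::_) $ i $ j = e i * (Diag x :: real^'n::_^'m::_) $ q i $ q' j * 1" for i j
    proof (cases "idx i = idx j")
      case True
      then have lt: "idx i < CARD('r)"
        using idx_less_CARD[of i] idx_less_CARD[of j] r by simp
      then have k: "idx (inv idx (idx i) :: 'r) = idx i" by (rule idx_inv_idx)
      have "idx (q i) = idx (p (inv idx (idx i)))" "idx (q' j) = idx (p (inv idx (idx i)))"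
        using q(2) q'(2) k True by metis+
      then show ?thesis
        using True lt by (simp add: Diag_nth[OF r] S signed_permutation_matrix_vec e_def)
    next
      case False
      \<comment> \<open>A common position would be below \<open>CARD('r)\<close>; as surplus indices
        are fixed, \<open>i\<close> and \<open>j\<close> would then lie there too, and injectivity
        of \<open>p\<close> would equate their positions.\<close>
      have "idx (q i) \<noteq> idx (q' j)"
      proof
        assume eq: "idx (q i) = idx (q' j)"
        then have lt: "idx (q i) < CARD('r)" "idx (q' j) < CARD('r)"
          using idx_less_CARD[of "q i"] idx_less_CARD[of "q' j"] r by auto
        then have "idx i < CARD('r)" "idx j < CARD('r)" using q(3) q'(3) by metis+
        then obtain k l :: 'r where "idx i = idx k" "idx j = idx l"
          by (metis idx_inv_idx)
        then show False using q(2) q'(2) eq False p by (metis idx_eq_iff injD)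
      qed
      then show ?thesis using False by (simp add: Diag_nth[OF r])
    qed
    then show "Diag (S *v x) = P ** Diag x ** transpose Q"
      unfolding vec_eq_iff P_def Q_def signed_permutation_matrix_nth_mul by blast
  qed
qed

section \<open>Existence of singular value decompositions\<close>

lemma continuous_on_matrix_mult:
  fixes f :: "'b::topological_space \<Rightarrow> real^'n^'m"
  assumes "continuous_on S f" "continuous_on S g"
  shows "continuous_on S (\<lambda>x. f x ** g x)"
  unfolding matrix_matrix_mult_def
  by (intro continuous_on_vec_lambda continuous_on_sum continuous_on_mult continuous_on_component assms)

lemma continuous_on_transpose:
  fixes f :: "'b::topological_space \<Rightarrow> real^'n^'m"
  assumes "continuous_on S f"
  shows "continuous_on S (\<lambda>x. transpose (f x))"
  unfolding transpose_def
  by (intro continuous_on_vec_lambda continuous_on_component assms)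

text \<open>Rows of unit norm give boundedness, a continuous defining equation gives
  closedness.\<close>

lemma compact_orthogonal_matrices: "compact {U :: real^'a^'a. orthogonal_matrix U}"
  unfolding compact_eq_bounded_closed
proof
  have "norm U \<le> real CARD('a)" if "orthogonal_matrix U" for U :: "real^'a^'a"
  proof -
    have "norm (U $ i) = 1" for i
      using that unfolding orthogonal_matrix_orthonormal_rows row_def by simp
    then show ?thesis
      unfolding norm_vec_def by (intro order_trans[OF L2_set_le_sum]) auto
  qed
  then show "bounded {U :: real^'a^'a. orthogonal_matrix U}"
    unfolding bounded_iff by blast
  have "continuous_on UNIV (\<lambda>U :: real^'a^'a. transpose U ** U)"
    by (intro continuous_on_matrix_mult continuous_on_transpose continuous_on_id)
  then show "closed {U :: real^'a^'a. orthogonal_matrix U}"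
    unfolding orthogonal_matrix by (intro closed_Collect_eq continuous_on_const)
qed

text \<open>Rotating the coordinates \<open>a\<close> and \<open>b\<close> by an angle \<open>t\<close> changes the trace by
  \<open>(cos t - 1) (B\<^sub>a\<^sub>a + B\<^sub>b\<^sub>b) + sin t (B\<^sub>b\<^sub>a - B\<^sub>a\<^sub>b)\<close>, which must not become positive.\<close>

lemma symmetric_if_trace_maximal:
  fixes B :: "real^'a^'a"
  assumes max: "\<And>P. orthogonal_matrix P \<Longrightarrow> trace (P ** B) \<le> trace B"
  shows "transpose B = B"
proof -
  have "B $ b $ a = B $ a $ b" if ab: "a \<noteq> b" for a b
  proof -
    let ?u = "B $ a $ a + B $ b $ b" and ?v = "B $ b $ a - B $ a $ b"
    have *: "c * ?u + s * ?v \<le> ?u" if cs: "c\<^sup>2 + s\<^sup>2 = 1" for c s :: real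
    proof -
      define P :: "real^'a^'a" where "P = (\<chi> i j. if i = a then (if j = a then c else if j = b then s else 0)
        else if i = b then (if j = a then - s else if j = b then c else 0) else if i = j then 1 else 0)"
      have split: "sum f UNIV = f a + f b + sum f (- {a, b})" for f :: "'a \<Rightarrow> real"
        using sum.subset_diff[of "{a, b}" UNIV f] ab by (simp add: Compl_eq_Diff_UNIV add.commute)
      \<comment> \<open>Used twice: with \<open>M = transpose P\<close> for orthogonality of the
        rotation, and with \<open>M = B\<close> for the trace.\<close>
      have rows: "(P ** M) $ i $ j = (if i = a then c * M $ a $ j + s * M $ b $ j
          else if i = b then c * M $ b $ j - s * M $ a $ j else M $ i $ j)" for M :: "real^'a^'a" and i j
      proof -
        have "P $ i $ k * M $ k $ j = (if i = a then (if k = a then c * M $ a $ j else 0) + (if k = b then s * M $ b $ j else 0)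
            else if i = b then (if k = b then c * M $ b $ j else 0) + (if k = a then - s * M $ a $ j else 0)
            else if k = i then M $ i $ j else 0)" for k
          using ab by (simp add: P_def)
        then show ?thesis
          using ab by (simp add: matrix_matrix_mult_def sum.distrib)
      qed
      have "P ** transpose P = mat 1"
        unfolding vec_eq_iff rows
        using ab cs by (auto simp: P_def transpose_def mat_def power2_eq_square algebra_simps)
      then have "orthogonal_matrix P"
        by (simp add: orthogonal_matrix matrix_left_right_inverse)
      then have "trace (P ** B) \<le> trace B" by (rule max)
      then show ?thesis
        using ab by (simp add: trace_def split rows algebra_simps)
    qed
    have "?v = 0"
    proof (rule ccontr)
      assume v: "?v \<noteq> 0"
      \<comment> \<open>The unit vector along \<open>(?u, ?v)\<close> maximises
        \<open>c * ?u + s * ?v\<close>, with value \<open>h\<close>. The bound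
        \<open>h \<le> ?u\<close> is impossible for nonzero \<open>?v\<close>.\<close>
      define h where "h = sqrt (?u\<^sup>2 + ?v\<^sup>2)"
      have h2: "h\<^sup>2 = ?u\<^sup>2 + ?v\<^sup>2" unfolding h_def by simp
      have h: "h > 0" using v unfolding h_def by (simp add: sum_power2_gt_zero_iff)
      have "(?u / h)\<^sup>2 + (?v / h)\<^sup>2 = h\<^sup>2 / h\<^sup>2"
        unfolding power_divide add_divide_distrib[symmetric] h2 ..
      then have "(?u / h)\<^sup>2 + (?v / h)\<^sup>2 = 1" using h by simp
      from *[OF this] have "?u / h * ?u + ?v / h * ?v \<le> ?u" .
      moreover have "?u / h * ?u + ?v / h * ?v = h * h / h"
        unfolding h2[unfolded power2_eq_square] add_divide_distrib[symmetric] times_divide_eq_left ..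
      ultimately have "h \<le> ?u"
        using h by simp
      then have "h\<^sup>2 \<le> ?u\<^sup>2" using h by (intro power_mono) auto
      then show False using h2 v by simp
    qed
    then show ?thesis by simp
  qed
  then show ?thesis by (auto simp: vec_eq_iff transpose_def) metis
qed

text \<open>Here \<open>x\<close> is only known to be nonnegative and nonincreasing;
  \<open>singular_values_eq\<close> identifies it with \<open>singular_values D\<close>.\<close>

lemma svd_exists:
  fixes D :: "real^'n::{finite,linorder}^'m::{finite,linorder}"
  assumes r: "CARD('r::{finite,linorder}) = min (CARD('m)) (CARD('n))"
  obtains U V and x :: "real^'r::{finite,linorder}" where
    "orthogonal_matrix U" "orthogonal_matrix V" "D = U ** Diag x ** transpose V"
    "\<And>i. 0 \<le> x $ i" "\<And>i j. i \<le> j \<Longrightarrow> x $ j \<le> x $ i"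
proof -
  \<comment> \<open>The weights are \<open>CARD('r)\<close> down to 1, in order of position.\<close>
  define w :: "real^'r::_" where "w = (\<chi> k. real (CARD('r) - idx k))"
  have w_pos: "w $ k > 0" for k using idx_less_CARD[of k] by (simp add: w_def)
  have w_dec: "w $ l < w $ k" if "k < l" for k l
    using idx_less[OF that] idx_less_CARD[of k] by (simp add: w_def)
  define W :: "real^'n::_^'m::_" where "W = Diag w"
  let ?O = "{U :: real^'m::_^'m::_. orthogonal_matrix U} \<times> {V :: real^'n::_^'n::_. orthogonal_matrix V}"
  let ?f = "\<lambda>(U, V). trace (transpose W ** (transpose U ** D ** V))"
  have "continuous_on ?O ?f"
    unfolding case_prod_unfold trace_def
    by (intro continuous_on_sum continuous_on_component continuous_on_matrix_mult
        continuous_on_transpose continuous_on_fst continuous_on_snd continuous_on_id continuous_on_const)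
  moreover have "compact ?O" by (intro compact_Times compact_orthogonal_matrices)
  moreover have "(mat 1, mat 1) \<in> ?O" by (simp add: orthogonal_matrix_id)
  ultimately obtain UV where "UV \<in> ?O" "\<And>UV'. UV' \<in> ?O \<Longrightarrow> ?f UV' \<le> ?f UV"
    using continuous_attains_sup[of ?O ?f] by blast
  then obtain U V where U: "orthogonal_matrix U" and V: "orthogonal_matrix V"
    and max0: "\<And>U' V'. orthogonal_matrix U' \<Longrightarrow> orthogonal_matrix V' \<Longrightarrow>
      trace (transpose W ** (transpose U' ** D ** V')) \<le> trace (transpose W ** (transpose U ** D ** V))"
    by (cases UV) fastforce
  define A where "A = transpose U ** D ** V"
  have D: "D = U ** A ** transpose V"
  proof -
    have "U ** A ** transpose V = (U ** transpose U) ** D ** (V ** transpose V)"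
      unfolding A_def by (simp add: matrix_mul_assoc)
    then show ?thesis using U V by (simp add: orthogonal_matrix_def)
  qed
  \<comment> \<open>Translating by the maximiser moves the optimum to the identity pair: compare
    with \<open>U ** transpose P\<close> and \<open>V ** Q\<close>.\<close>
  have max: "trace (transpose W ** (P ** A ** Q)) \<le> trace (transpose W ** A)"
    if "orthogonal_matrix P" "orthogonal_matrix Q" for P Q
    using max0[of "U ** transpose P" "V ** Q"] U V that
    by (simp add: orthogonal_matrix_mul A_def matrix_transpose_mul matrix_mul_assoc)
  have "transpose (A ** transpose W) = A ** transpose W"
  proof (rule symmetric_if_trace_maximal)
    fix P :: "real^'m::_^'m::_" assume "orthogonal_matrix P"
    then have "trace (transpose W ** (P ** A)) \<le> trace (transpose W ** A)"
      using max[of P "mat 1"] by (simp add: orthogonal_matrix_id)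
    then show "trace (P ** (A ** transpose W)) \<le> trace (A ** transpose W)"
      by (metis trace_mul_sym matrix_mul_assoc)
  qed
  moreover have "transpose (transpose W ** A) = transpose W ** A"
  proof (rule symmetric_if_trace_maximal)
    fix Q :: "real^'n::_^'n::_" assume "orthogonal_matrix Q"
    then have "trace (transpose W ** (A ** Q)) \<le> trace (transpose W ** A)"
      using max[of "mat 1" Q] by (simp add: orthogonal_matrix_id)
    then show "trace (Q ** (transpose W ** A)) \<le> trace (transpose W ** A)"
      by (metis trace_mul_sym matrix_mul_assoc)
  qed
  \<comment> \<open>By the two symmetries, both sides equal
    \<open>W ** transpose A ** W\<close>.\<close>
  ultimately have "A ** transpose W ** W = W ** (transpose W ** A)"
    by (metis matrix_transpose_mul matrix_mul_assoc transpose_transpose)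
  then have eq: "A ** (transpose W ** W) = (W ** transpose W) ** A"
    by (simp add: matrix_mul_assoc)
  \<comment> \<open>Natural subtraction truncates, so the surplus positions automatically get weight
    0.\<close>
  have WW: "(transpose W ** W) $ i $ j = (if i = j then (real (CARD('r) - idx i))\<^sup>2 else 0)" for i j
    by (simp add: W_def transpose_Diag_mul_Diag_nth[OF r] w_def idx_inv_idx)
  have r': "CARD('r) = min (CARD('n)) (CARD('m))"
    using r by (simp add: min.commute)
  have WW': "(W ** transpose W) $ i $ j = (if i = j then (real (CARD('r) - idx i))\<^sup>2 else 0)" for i j
    using transpose_Diag_mul_Diag_nth[OF r', of w i j]
    by (simp add: W_def transpose_Diag[OF r] transpose_Diag[OF r'] w_def idx_inv_idx)
  have A0: "A $ i $ j = 0" if "idx i \<noteq> idx j" for i j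
  proof -
    have "A $ i $ j * (real (CARD('r) - idx j))\<^sup>2 = (A ** (transpose W ** W)) $ i $ j"
      by (subst matrix_matrix_mult_def) (simp add: WW if_distrib[of "\<lambda>x. _ * x"] cong: if_cong)
    also have "\<dots> = (real (CARD('r) - idx i))\<^sup>2 * A $ i $ j"
      unfolding eq by (subst matrix_matrix_mult_def)
        (simp add: WW' if_distrib[of "\<lambda>x. x * _"] cong: if_cong)
    \<comment> \<open>At least one of the two positions is below \<open>CARD('r)\<close>, so its
      weight is positive and truncation cannot make distinct positions share a weight.\<close>
    finally have "A $ i $ j = 0 \<or> CARD('r) - idx i = CARD('r) - idx j" by auto
    then show ?thesis
      using that r idx_less_CARD[of i] idx_less_CARD[of j] by (auto simp: min_def split: if_splits)
  qed
  \<comment> \<open>The two copies of \<open>inv idx (idx k)\<close> have types \<open>'m\<close>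
    and \<open>'n\<close>: the row and the column at the position of \<open>k\<close>.\<close>
  define x :: "real^'r::_" where "x = (\<chi> k. A $ inv idx (idx k) $ inv idx (idx k))"
  have AD: "A = Diag x"
    unfolding vec_eq_iff
  proof (intro allI)
    fix i j
    show "A $ i $ j = Diag x $ i $ j"
    proof (cases "idx i = idx j")
      case True
      then have "idx i < CARD('r)" using idx_less_CARD[of i] idx_less_CARD[of j] r by simp
      then show ?thesis using True idx_inv_idx[of "idx i", where 'a = 'r]
        by (simp add: Diag_nth[OF r] x_def) (metis inv_idx_idx)
    qed (simp add: A0 Diag_nth[OF r])
  qed
  \<comment> \<open>A signed permutation of \<open>x\<close> is realised by an orthogonal pair, so
    maximality bounds its inner product with \<open>w\<close> by
    \<open>w \<bullet> x\<close>.\<close>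
  have sp: "0 \<le> (\<Sum>k\<in>UNIV. w $ k * (x $ k - s k * x $ p k))"
    if "p permutes UNIV" "\<And>i. s i = 1 \<or> s i = -1" for p s
  proof -
    let ?S = "\<chi> i j. if j = p i then s i else 0"
    have "signed_permutation_matrix ?S" 
      unfolding signed_permutation_matrix_def by (intro exI[of _ p] exI[of _ s] conjI allI that refl)
    then obtain P :: "real^'m::_^'m::_" and Q :: "real^'n::_^'n::_"
      where "orthogonal_matrix P" "orthogonal_matrix Q" "Diag (?S *v x) = P ** Diag x ** transpose Q"
      using Diag_signed_permutation[OF r] by blast
    then have "trace (transpose W ** Diag (?S *v x)) \<le> trace (transpose W ** Diag x)"
      using max[of P "transpose Q"] AD by simp
    then have "w \<bullet> (?S *v x) \<le> w \<bullet> x"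
      unfolding W_def trace_transpose_Diag_mul[OF r] .
    then show ?thesis
      by (simp add: inner_vec_def signed_permutation_matrix_vec algebra_simps sum_subtractf)
  qed
  have nonneg: "0 \<le> x $ i" for i
  proof -
    \<comment> \<open>Flipping the sign of coordinate \<open>i\<close> alone isolates
      \<open>x $ i\<close>.\<close>
    have "0 \<le> (\<Sum>k\<in>UNIV. w $ k * (x $ k - (if k = i then -1 else 1) * x $ id k))"
      by (intro sp permutes_id) auto
    also have "\<dots> = (\<Sum>k\<in>UNIV. if k = i then 2 * w $ k * x $ k else 0)"
      by (intro sum.cong) auto
    finally show ?thesis using w_pos[of i] by (simp add: zero_le_mult_iff)
  qed
  have "x $ j \<le> x $ i" if "i < j" for i j
  proof -
    let ?t = "Transposition.transpose i j"
    \<comment> \<open>Swapping coordinates \<open>i\<close> and \<open>j\<close> leaves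
      \<open>(w $ i - w $ j) * (x $ i - x $ j)\<close>, whose first factor is positive.\<close>
    have "0 \<le> (\<Sum>k\<in>UNIV. w $ k * (x $ k - 1 * x $ ?t k))"
      by (intro sp permutes_swap_id) auto
    also have "\<dots> = (\<Sum>k\<in>{i, j}. w $ k * (x $ k - 1 * x $ ?t k))"
      by (rule sum.mono_neutral_right) (auto simp: Transposition.transpose_def)
    also have "\<dots> = (w $ i - w $ j) * (x $ i - x $ j)"
      using that by (auto simp: algebra_simps)
    finally show ?thesis using w_dec[OF that] by (simp add: zero_le_mult_iff)
  qed
  then show thesis
    using that[OF U V] D AD nonneg by (metis order.order_iff_strict)
qed

section \<open>The singular values of a decomposed matrix\<close>

lemma matrix_diff_ldistrib: "A ** (B - C) = A ** B - A ** C"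
  for A :: "'a::comm_ring_1^'n^'m"
  by (simp add: vec_eq_iff matrix_matrix_mult_def algebra_simps sum_subtractf)

lemma matrix_diff_rdistrib: "(A - B) ** C = A ** C - B ** C"
  for A :: "'a::comm_ring_1^'n^'m"
  by (simp add: vec_eq_iff matrix_matrix_mult_def algebra_simps sum_subtractf)

lemma mat_mul_commute: "mat c ** A = A ** mat c" for A :: "'a::comm_ring_1^'n^'n"
  by (simp add: vec_eq_iff matrix_matrix_mult_def mat_def if_distrib[of "\<lambda>x. x * _"]
      if_distrib[of "\<lambda>x. _ * x"] mult.commute cong: if_cong)

lemma sum_const_poly: "(\<Sum>i\<in>I. [:f i:]) = [:\<Sum>i\<in>I. f i:]"
  by (induction I rule: infinite_finite_induct) auto

text \<open>Embedding entries as constant polynomials is multiplicative, and the scalar matrix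
  \<open>mat [:0, 1:]\<close> commutes with every matrix, so the conjugation factors out of the
  determinant.\<close>

lemma charpoly_orthogonal_conjugate:
  fixes V E :: "real^'n^'n"
  assumes V: "orthogonal_matrix V"
  shows "charpoly (V ** E ** transpose V) = charpoly E"
proof -
  define C where "C A = (\<chi> i j. [:A $ i $ j:])" for A :: "real^'n^'n"
  have C_mul: "C (A ** B) = C A ** C B" for A B
    by (simp add: C_def vec_eq_iff matrix_matrix_mult_def sum_const_poly[symmetric] mult.commute)
  have C_1: "C (mat 1) = mat 1"
    by (auto simp: C_def vec_eq_iff mat_def)
  have VV: "C V ** C (transpose V) = mat 1"
    using V by (simp add: C_mul[symmetric] orthogonal_matrix_def C_1)
  have "mat [:0, 1:] - C (V ** E ** transpose V)
      = C V ** (mat [:0, 1:] - C E) ** C (transpose V)"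
    by (simp add: matrix_diff_ldistrib matrix_diff_rdistrib C_mul mat_mul_commute[symmetric])
      (simp add: matrix_mul_assoc[symmetric] VV)
  then have "det (mat [:0, 1:] - C (V ** E ** transpose V))
      = det (mat [:0, 1:] - C E) * det (C V ** C (transpose V))"
    by (simp add: det_mul)
  moreover have "charpoly A = det (mat [:0, 1:] - C A)" for A
    by (simp add: charpoly_def C_def)
  ultimately show ?thesis
    by (simp add: VV)
qed

lemma proots_charpoly_diagonal:
  fixes e :: "'n::finite \<Rightarrow> real"
  shows "proots (charpoly (\<chi> i j. if i = j then e i else 0)) = image_mset e (mset_set UNIV)"
proof -
  have "charpoly (\<chi> i j. if i = j then e i else 0) = (\<Prod>i\<in>UNIV. [:- e i, 1:])"
    unfolding charpoly_def by (subst det_diagonal) (auto simp: mat_def)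
  also have "proots \<dots> = (\<Sum>i\<in>UNIV. {#e i#})"
    by (subst proots_prod) auto
  also have "\<dots> = image_mset e (mset_set UNIV)"
    by (simp add: sum_unfold_sum_mset image_mset.compositionality comp_def)
  finally show ?thesis .
qed

text \<open>\<open>transpose D ** D\<close> is orthogonally similar to the diagonal matrix of the
  squares of \<open>x\<close>, padded with zeros; nonnegativity and order then recover
  \<open>x\<close> from the spectrum.\<close>

lemma singular_values_eq:
  fixes x :: "real^'r::{finite,linorder}" and D :: "real^'n::{finite,linorder}^'m::{finite,linorder}"
  assumes r: "CARD('r) = min (CARD('m)) (CARD('n))"
    and U: "orthogonal_matrix U" and V: "orthogonal_matrix V"
    and D: "D = U ** Diag x ** transpose V"
    and nonneg: "\<And>i. 0 \<le> x $ i" and dec: "\<And>i j. i \<le> j \<Longrightarrow> x $ j \<le> x $ i"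
  shows "singular_values D = x"
proof -
  \<comment> \<open>Pads \<open>x\<close> with zeros to the \<open>CARD('n)\<close> eigenvalues;
    since \<open>x\<close> is nonnegative, the padded sequence is still nonincreasing.\<close>
  define g where "g k = (if k < CARD('r) then x $ inv idx k else 0)" for k
  have g_nonneg: "0 \<le> g k" for k by (simp add: g_def nonneg)
  have g_dec: "g l \<le> g k" if "k \<le> l" for k l
  proof (cases "l < CARD('r)")
    case True
    then have "(inv idx k :: 'r) \<le> inv idx l"
      using that idx_less[of "inv idx l :: 'r" "inv idx k"] by (force simp: idx_inv_idx)
    then show ?thesis using True that dec by (simp add: g_def)
  next
    case False
    then show ?thesis by (simp add: g_def nonneg)
  qed
  let ?X = "Diag x :: real^'n::_^'m::_"
  have "transpose ?X ** ?X = (\<chi> i j. if i = j then (g (idx i))\<^sup>2 else 0)"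
    by (simp add: vec_eq_iff transpose_Diag_mul_Diag_nth[OF r] g_def)
  moreover have "transpose D ** D = V ** (transpose ?X ** ?X) ** transpose V"
  proof -
    have "transpose D ** D = V ** transpose ?X ** (transpose U ** U) ** ?X ** transpose V"
      unfolding D by (simp add: matrix_transpose_mul matrix_mul_assoc)
    moreover have "transpose U ** U = mat 1" using U by (simp add: orthogonal_matrix)
    ultimately show ?thesis by (simp only: matrix_mul_rid matrix_mul_assoc)
  qed
  ultimately have "proots (charpoly (transpose D ** D))
      = image_mset (\<lambda>i. (g (idx i))\<^sup>2) (mset_set (UNIV :: 'n set))"
    by (simp add: charpoly_orthogonal_conjugate[OF V] proots_charpoly_diagonal)
  then have "image_mset sqrt (proots (charpoly (transpose D ** D)))
      = image_mset g (image_mset idx (mset_set (UNIV :: 'n set)))"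
    by (simp add: image_mset.compositionality comp_def g_nonneg)
  \<comment> \<open>Listed in increasing order, so that \<open>sort\<close> changes nothing and the
    outer \<open>rev\<close> of \<open>singular_value_list\<close> restores the order of
    \<open>g\<close>.\<close>
  also have "\<dots> = mset (rev (map g [0..<CARD('n)]))"
    by (simp add: image_mset_mset_set[OF inj_idx] range_idx lessThan_atLeast0)
  finally have "singular_value_list D = rev (sort (rev (map g [0..<CARD('n)])))"
    unfolding singular_value_list_def by (simp del: mset_rev mset_map)
  also have "sort (rev (map g [0..<CARD('n)])) = rev (map g [0..<CARD('n)])"
    by (rule sorted_sort_id) (auto simp: sorted_iff_nth_mono rev_nth intro!: g_dec)
  finally have "singular_value_list D = map g [0..<CARD('n)]" by simp
  moreover have "idx i < CARD('n)" for i :: 'r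
    using idx_less_CARD[of i] r by simp
  ultimately show ?thesis
    by (simp add: vec_eq_iff singular_values_def g_def idx_less_CARD)
qed

section \<open>Equivariance and spectral operators\<close>

lemma equivariant_imp_spectral:
  fixes F :: "real^'n::{finite,linorder}^'m::{finite,linorder} \<Rightarrow> real^'n::{finite,linorder}^'m::{finite,linorder}"
  assumes r: "CARD('r::{finite,linorder}) = min (CARD('m)) (CARD('n))"
    and equi: "\<And>D P Q. orthogonal_matrix P \<Longrightarrow> orthogonal_matrix Q \<Longrightarrow>
      F (P ** D ** transpose Q) = P ** F D ** transpose Q"
  shows "\<exists>\<psi> :: real^'r::{finite,linorder} \<Rightarrow> real^'r::{finite,linorder}. spectral_operator_of \<psi> F"
proof -
  have F0: "F (Diag x) $ i $ j = 0" if ij: "idx i \<noteq> idx j" for x :: "real^'r::_" and i j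
  proof -
    \<comment> \<open>Negate the row and the column at position \<open>idx i\<close>: the signs
      cancel on the diagonal, but the entry at \<open>i\<close>, \<open>j\<close> changes sign.
      Writing \<open>id a\<close> matches \<open>signed_permutation_matrix_nth_mul\<close>.\<close>
    let ?P = "(\<chi> a b. if b = id a then (if idx a = idx i then -1 else 1) else 0) :: real^'m::_^'m::_"
    let ?Q = "(\<chi> a b. if b = id a then (if idx a = idx i then -1 else 1) else 0) :: real^'n::_^'n::_"
    have "?P ** Diag x ** transpose ?Q = Diag x"
      unfolding vec_eq_iff signed_permutation_matrix_nth_mul by (auto simp: Diag_nth[OF r])
    moreover have "orthogonal_matrix ?P" "orthogonal_matrix ?Q"
      by (rule orthogonal_signed_permutation; simp)+
    ultimately have "F (Diag x) = ?P ** F (Diag x) ** transpose ?Q"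
      using equi[of ?P ?Q "Diag x"] by (simp only:)
    then have "F (Diag x) $ i $ j = (?P ** F (Diag x) ** transpose ?Q) $ i $ j" by simp
    also have "\<dots> = - F (Diag x) $ i $ j"
      unfolding signed_permutation_matrix_nth_mul using ij by simp
    finally show ?thesis by simp
  qed
  define \<psi> :: "real^'r::_ \<Rightarrow> real^'r::_"
    where "\<psi> x = (\<chi> k. F (Diag x) $ inv idx (idx k) $ inv idx (idx k))" for x
  have F_Diag: "F (Diag x) = Diag (\<psi> x)" for x
    unfolding vec_eq_iff
  proof (intro allI)
    fix i j
    show "F (Diag x) $ i $ j = Diag (\<psi> x) $ i $ j"
    proof (cases "idx i = idx j")
      case True
      then have "idx i < CARD('r)" using idx_less_CARD[of i] idx_less_CARD[of j] r by simp
      then show ?thesis using True idx_inv_idx[of "idx i", where 'a = 'r]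
        by (simp add: Diag_nth[OF r] \<psi>_def) (metis inv_idx_idx)
    qed (simp add: F0 Diag_nth[OF r])
  qed
  have Diag_inj: "x = y" if "(Diag x :: real^'n::_^'m::_) = Diag y" for x y :: "real^'r::_"
    unfolding vec_eq_iff
  proof
    fix k :: 'r
    have "idx (inv idx (idx k) :: 'm) = idx k" "idx (inv idx (idx k) :: 'n) = idx k"
      using idx_less_CARD[of k] r by (auto intro!: idx_inv_idx)
    then have "(Diag z :: real^'n::_^'m::_) $ inv idx (idx k) $ inv idx (idx k) = z $ k" for z :: "real^'r::_"
      by (simp add: Diag_nth[OF r])
    then show "x $ k = y $ k" using that by metis
  qed
  have "absolutely_symmetric \<psi>"
    unfolding absolutely_symmetric_def
  proof (intro allI impI)
    fix x and S :: "real^'r::_^'r::_"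
    assume "signed_permutation_matrix S"
    then obtain P :: "real^'m::_^'m::_" and Q :: "real^'n::_^'n::_"
      where "orthogonal_matrix P" "orthogonal_matrix Q"
        and "\<And>x. Diag (S *v x) = P ** Diag x ** transpose Q"
      using Diag_signed_permutation[OF r] by blast
    \<comment> \<open>Equivariance moves \<open>P\<close> and \<open>Q\<close> outside
      \<open>F\<close>; the same pair, applied to the vector \<open>\<psi> x\<close>, then turns the
      result back into a diagonal matrix.\<close>
    then have "(Diag (\<psi> (S *v x)) :: real^'n::_^'m::_) = Diag (S *v \<psi> x)"
      using equi by (metis F_Diag)
    then show "\<psi> (S *v x) = S *v \<psi> x" by (rule Diag_inj)
  qed
  then show ?thesis
    unfolding spectral_operator_of_def is_svd_def using equi F_Diag by metis
qed

text \<open>If \<open>U\<close>, \<open>x\<close>, \<open>V\<close> decompose \<open>D\<close>, then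
  \<open>P ** U\<close>, \<open>x\<close>, \<open>Q ** V\<close> decompose
  \<open>P ** D ** transpose Q\<close> with the same singular values, so both values of
  \<open>F\<close> contain the same \<open>\<psi> x\<close>.\<close>

lemma spectral_imp_equivariant:
  fixes F :: "real^'n::{finite,linorder}^'m::{finite,linorder} \<Rightarrow> real^'n::{finite,linorder}^'m::{finite,linorder}"
    and \<psi> :: "real^'r::{finite,linorder} \<Rightarrow> real^'r::{finite,linorder}"
  assumes r: "CARD('r) = min (CARD('m)) (CARD('n))"
    and \<psi>: "spectral_operator_of \<psi> F"
    and P: "orthogonal_matrix P" and Q: "orthogonal_matrix Q"
  shows "F (P ** D ** transpose Q) = P ** F D ** transpose Q"
proof -
  obtain U V and x :: "real^'r::_" where U: "orthogonal_matrix U" and V: "orthogonal_matrix V"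
    and D: "D = U ** Diag x ** transpose V"
    and x: "\<And>i. 0 \<le> x $ i" "\<And>i j. i \<le> j \<Longrightarrow> x $ j \<le> x $ i"
    using svd_exists[OF r] by metis
  have PU: "orthogonal_matrix (P ** U)" and QV: "orthogonal_matrix (Q ** V)"
    using P Q U V by (auto intro: orthogonal_matrix_mul)
  have PDQ: "P ** D ** transpose Q = (P ** U) ** Diag x ** transpose (Q ** V)"
    unfolding D by (simp add: matrix_transpose_mul matrix_mul_assoc)
  have "is_svd D U x V" "is_svd (P ** D ** transpose Q) (P ** U) x (Q ** V)"
    unfolding is_svd_def
    using U V D PU QV PDQ singular_values_eq[OF r U V D x] singular_values_eq[OF r PU QV PDQ x]
    by auto
  then have "F D = U ** Diag (\<psi> x) ** transpose V"
    and "F (P ** D ** transpose Q) = (P ** U) ** Diag (\<psi> x) ** transpose (Q ** V)"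
    using \<psi> unfolding spectral_operator_of_def by blast+
  then show ?thesis
    by (simp add: matrix_transpose_mul matrix_mul_assoc)
qed

theorem theorem3p7:
  fixes F :: "real^'n::{finite,linorder}^'m::{finite,linorder} \<Rightarrow>
              real^'n::{finite,linorder}^'m::{finite,linorder}"
  assumes "CARD('r::{finite,linorder}) = min (CARD('m)) (CARD('n))"
    and "continuous_on UNIV F"
  shows "(\<forall>D P Q. orthogonal_matrix P \<and> orthogonal_matrix Q \<longrightarrow>
            F (P ** D ** transpose Q) = P ** F D ** transpose Q) \<longleftrightarrow>
         (\<exists>\<psi> :: real^'r::{finite,linorder} \<Rightarrow> real^'r::{finite,linorder}. spectral_operator_of \<psi> F)"
  using equivariant_imp_spectral[OF assms(1)] spectral_imp_equivariant[OF assms(1)]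
  by metis

end
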